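(* Let $N=(N_t)_{t\in\mathbb{R}}$ be a fractional Brownian motion of index $H\in(0,1)$, and let $X$ be a QOU process driven by $N$ with parameter $\lambda>0$. For $H\in(0,1)\setminus\{\frac12\}$ and $t\to\infty$, $$\mathrm{R}_X(t)\sim\frac{H(2H-1)}{\lambda^2}\,t^{2H-2}.$$ For $H\in(0,1)$ and $t\to0$, $$\bar{\mathrm{R}}_X(t)\sim\tfrac12|t|^{2H}.$$
   Context: A fractional Brownian motion of index $H\in(0,1)$ is a continuous centered Gaussian process $(N_t)_{t\in\mathbb{R}}$ with stationary increments, $N_0=0$ and $\operatorname{Var}(N_t)=|t|^{2H}$. A QOU process driven by $N$ with parameter $\lambda>0$ is a stationary process $X=(X_t)_{t\in\mathbb{R}}$ satisfying $X_t=X_0-\lambda\int_0^tX_s\,ds+N_t$ for all $t\in\mathbb{R}$, where the integral is a pathwise Lebesgue integral (with $\int_0^t=-\int_t^0$ for $t<0$). $\mathrm{R}_X(t)=\operatorname{Cov}(X_t,X_0)$ and $\bar{\mathrm{R}}_X(t)=\mathrm{R}_X(0)-\mathrm{R}_X(t)=\frac12E[(X_t-X_0)^2]$. $f(t)\sim g(t)$ means $f(t)/g(t)\to1$. *)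

theory Defs
  imports "HOL-Probability.Probability" "HOL-Library.Landau_Symbols"
begin

definition real_process :: "'a measure \<Rightarrow> (real \<Rightarrow> 'a \<Rightarrow> real) \<Rightarrow> bool" where
  "real_process M X \<longleftrightarrow> prob_space M \<and> (\<forall>t. X t \<in> borel_measurable M)"

definition same_fdd ::
  "'a measure \<Rightarrow> (real \<Rightarrow> 'a \<Rightarrow> real) \<Rightarrow> (real \<Rightarrow> 'a \<Rightarrow> real) \<Rightarrow> bool" where
  "same_fdd M X Y \<longleftrightarrow>
     (\<forall>J. finite J \<longrightarrow>
        distr M (Pi\<^sub>M J (\<lambda>_. borel)) (\<lambda>\<omega>. \<lambda>t\<in>J. X t \<omega>) =
        distr M (Pi\<^sub>M J (\<lambda>_. borel)) (\<lambda>\<omega>. \<lambda>t\<in>J. Y t \<omega>))"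

(* Stationarity is strict (equality of finite-dimensional distributions); no moments are required. *)
definition stationary_process :: "'a measure \<Rightarrow> (real \<Rightarrow> 'a \<Rightarrow> real) \<Rightarrow> bool" where
  "stationary_process M X \<longleftrightarrow> real_process M X \<and> (\<forall>h. same_fdd M (\<lambda>t. X (t + h)) X)"

definition stationary_increments :: "'a measure \<Rightarrow> (real \<Rightarrow> 'a \<Rightarrow> real) \<Rightarrow> bool" where
  "stationary_increments M X \<longleftrightarrow>
     (\<forall>h. same_fdd M (\<lambda>t \<omega>. X (t + h) \<omega> - X h \<omega>) (\<lambda>t \<omega>. X t \<omega> - X 0 \<omega>))"

(* Point masses count as Gaussian (variance 0). *)
definition gaussian_rv :: "'a measure \<Rightarrow> ('a \<Rightarrow> real) \<Rightarrow> bool" where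
  "gaussian_rv M Z \<longleftrightarrow>
     (\<exists>m \<sigma>. 0 < \<sigma> \<and> distributed M lborel Z (\<lambda>x. ennreal (normal_density m \<sigma> x))) \<or>
     (\<exists>m. Z \<in> borel_measurable M \<and> (AE \<omega> in M. Z \<omega> = m))"

definition gaussian_process :: "'a measure \<Rightarrow> (real \<Rightarrow> 'a \<Rightarrow> real) \<Rightarrow> bool" where
  "gaussian_process M X \<longleftrightarrow>
     real_process M X \<and>
     (\<forall>J a. finite J \<longrightarrow> gaussian_rv M (\<lambda>\<omega>. \<Sum>t\<in>J. a t * X t \<omega>))"

definition covariance :: "'a measure \<Rightarrow> ('a \<Rightarrow> real) \<Rightarrow> ('a \<Rightarrow> real) \<Rightarrow> real" where
  "covariance M Y Z =
     integral\<^sup>L M (\<lambda>\<omega>. (Y \<omega> - integral\<^sup>L M Y) * (Z \<omega> - integral\<^sup>L M Z))"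

(* The powr convention 0 powr a = 0 gives the correct variance at t = 0. *)
definition fractional_Brownian_motion ::
  "'a measure \<Rightarrow> real \<Rightarrow> (real \<Rightarrow> 'a \<Rightarrow> real) \<Rightarrow> bool" where
  "fractional_Brownian_motion M H N \<longleftrightarrow>
     0 < H \<and> H < 1 \<and>
     gaussian_process M N \<and>
     (AE \<omega> in M. continuous_on UNIV (\<lambda>t. N t \<omega>)) \<and>
     (\<forall>t. integral\<^sup>L M (N t) = 0) \<and>
     stationary_increments M N \<and>
     (AE \<omega> in M. N 0 \<omega> = 0) \<and>
     (\<forall>t. covariance M (N t) (N t) = \<bar>t\<bar> powr (2 * H))"

(* The interval integral is oriented, so that it is minus the integral over [t, 0] for t < 0.
   Integrability is required explicitly since the library integral is total.  The equation is
   required pathwise: outside a single null set it holds simultaneously for all t. *)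
definition QOU_process ::
  "'a measure \<Rightarrow> real \<Rightarrow> (real \<Rightarrow> 'a \<Rightarrow> real) \<Rightarrow> (real \<Rightarrow> 'a \<Rightarrow> real) \<Rightarrow> bool" where
  "QOU_process M lam N X \<longleftrightarrow>
     0 < lam \<and>
     stationary_process M X \<and>
     (AE \<omega> in M. \<forall>t::real.
        interval_lebesgue_integrable lborel (ereal 0) (ereal t) (\<lambda>s. X s \<omega>) \<and>
        X t \<omega> = X 0 \<omega> - lam * (LBINT s=ereal 0..ereal t. X s \<omega>) + N t \<omega>)"

definition autocov :: "'a measure \<Rightarrow> (real \<Rightarrow> 'a \<Rightarrow> real) \<Rightarrow> real \<Rightarrow> real" where
  "autocov M X t = covariance M (X t) (X 0)"

definition autocov_compl :: "'a measure \<Rightarrow> (real \<Rightarrow> 'a \<Rightarrow> real) \<Rightarrow> real \<Rightarrow> real" where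
  "autocov_compl M X t = autocov M X 0 - autocov M X t"

end

theory Submission
  imports Defs "HOL-Real_Asymp.Real_Asymp"
begin

text \<open>Write \<open>I t = \<integral>\<^sub>0\<^sup>t X\<close>. Taking second moments in \<open>N t = X t - X 0 + \<lambda> I t\<close> gives, by stationarity,
  \<open>R t = R 0 - t powr (2 H) / 2 + \<lambda>\<^sup>2 \<integral>\<^sub>0\<^sup>t \<integral>\<^sub>0\<^sup>s R\<close> for \<open>t \<ge> 0\<close>. As \<open>R\<close> is bounded, the double integral
  is \<open>O(t\<^sup>2)\<close>, which settles \<open>t \<rightarrow> 0\<close>; for \<open>t \<rightarrow> \<infinity>\<close>, differentiate twice and apply l'Hopital's rule
  to the two first-order factors of the resulting equation.

  Stationarity is assumed without moments, so \<open>X 0 \<in> L\<^sup>2\<close> has to be proved: solving the equation on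
  \<open>[0, 1]\<close> gives \<open>X 1 = exp (- \<lambda>) X 0 + W\<close> with \<open>W \<in> L\<^sup>2\<close>, and since \<open>X 1\<close> and \<open>X 0\<close> have the same
  law, iterating this contraction bounds the truncated second moments.\<close>

section \<open>The covariance equation\<close>

text \<open>The substitution \<open>x = 1 / y\<close> moves the limit to the right of 0, where the
  0/0 rule applies. The chain-rule factors \<open>- 1 / y^2\<close> cancel in the quotient of
  derivatives.\<close>

lemma lhopital_at_top_0:
  fixes f g :: "real \<Rightarrow> real"
  assumes f_0: "(f \<longlongrightarrow> 0) at_top" and g_0: "(g \<longlongrightarrow> 0) at_top"
    and g: "eventually (\<lambda>x. g x \<noteq> 0) at_top"
    and g': "eventually (\<lambda>x. g' x \<noteq> 0) at_top"
    and Df: "eventually (\<lambda>x. (f has_real_derivative f' x) (at x)) at_top"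
    and Dg: "eventually (\<lambda>x. (g has_real_derivative g' x) (at x)) at_top"
    and lim: "((\<lambda>x. f' x / g' x) \<longlongrightarrow> y) at_top"
  shows "((\<lambda>x. f x / g x) \<longlongrightarrow> y) at_top"
  unfolding filterlim_at_top_to_right
proof (rule lhopital_right_0)
  let ?D = "\<lambda>f' x. f' (inverse x) * - (inverse x ^ Suc (Suc 0)) :: real"
  show "((\<lambda>x. f (inverse x)) \<longlongrightarrow> 0) (at_right 0)" "((\<lambda>x. g (inverse x)) \<longlongrightarrow> 0) (at_right 0)"
    using f_0 g_0 by (simp_all add: filterlim_at_top_to_right)
  show "eventually (\<lambda>x. g (inverse x) \<noteq> 0) (at_right 0)"
    using g by (simp add: eventually_at_top_to_right)
  have pos: "eventually (\<lambda>x::real. x > 0) (at_right 0)"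
    by (simp add: eventually_at_right_less)
  show "eventually (\<lambda>x. ?D g' x \<noteq> 0) (at_right 0)"
    using g'[unfolded eventually_at_top_to_right] pos by eventually_elim auto
  show "eventually (\<lambda>x. DERIV (\<lambda>x. f (inverse x)) x :> ?D f' x) (at_right 0)"
    using Df[unfolded eventually_at_top_to_right] pos
    by eventually_elim (rule DERIV_chain'[OF DERIV_inverse], auto)
  show "eventually (\<lambda>x. DERIV (\<lambda>x. g (inverse x)) x :> ?D g' x) (at_right 0)"
    using Dg[unfolded eventually_at_top_to_right] pos
    by eventually_elim (rule DERIV_chain'[OF DERIV_inverse], auto)
  show "((\<lambda>x. ?D f' x / ?D g' x) \<longlongrightarrow> y) (at_right 0)"
  proof (rule Lim_transform_eventually)
    show "((\<lambda>x. f' (inverse x) / g' (inverse x)) \<longlongrightarrow> y) (at_right 0)"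
      using lim by (simp add: filterlim_at_top_to_right)
    show "eventually (\<lambda>x. f' (inverse x) / g' (inverse x) = ?D f' x / ?D g' x) (at_right 0)"
      using pos by eventually_elim simp
  qed
qed

text \<open>A purely deterministic setting on the half-line: the asymptotics follow from the
  integral equation, a uniform bound and integrability on compact intervals. The probabilistic part
  only has to supply these.\<close>

locale langevin_covariance =
  fixes R :: "real \<Rightarrow> real" and H lam C :: real
  assumes H: "0 < H" "H < 1" and lam: "0 < lam"
    and bounded: "0 \<le> t \<Longrightarrow> \<bar>R t\<bar> \<le> C"
    and integrable: "R integrable_on {0..t}"
    and volterra: "0 \<le> t \<Longrightarrow>
      R t = R 0 - t powr (2 * H) / 2 + lam\<^sup>2 * integral {0..t} (\<lambda>s. integral {0..s} R)"
begin

section \<open>Primitives and smoothness of the covariance\<close>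

definition B where "B s = integral {0..s} R"
definition A where "A t = integral {0..t} B"

lemma C_nonneg: "0 \<le> C"
  using bounded[of 0] by auto

lemma R_eq: "0 \<le> t \<Longrightarrow> R t = R 0 - t powr (2 * H) / 2 + lam\<^sup>2 * A t"
  unfolding A_def B_def[abs_def] by (rule volterra)

lemma continuous_B: "continuous_on {0..t} B"
  unfolding B_def by (rule indefinite_integral_continuous_1) (rule integrable)

lemma abs_B_le: "0 \<le> t \<Longrightarrow> \<bar>B t\<bar> \<le> C * t"
  using has_integral_bound_real[OF C_nonneg finite.emptyI integrable_integral[OF integrable[of t]]] bounded
  by (auto simp: B_def)

lemma abs_A_le: "0 \<le> t \<Longrightarrow> \<bar>A t\<bar> \<le> C * t * t"
proof -
  assume t: "0 \<le> t"
  have "\<bar>B s\<bar> \<le> C * t" if "s \<in> {0..t}" for s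
    using abs_B_le[of s] mult_left_mono[of s t C] C_nonneg that by auto
  then show ?thesis
    using has_integral_bound_real[of "C * t" "{}" B "A t" 0 t] t C_nonneg
      integrable_integral[OF integrable_continuous_real[OF continuous_B[of t]]]
    by (auto simp: A_def)
qed

text \<open>Bootstrapping: \<open>R\<close> is assumed only to be integrable, but the right-hand
  side of the integral equation contains it through the double primitive \<open>A\<close>, which is
  continuous. Continuity of \<open>R\<close> in turn makes \<open>B\<close> differentiable.\<close>

lemma continuous_R: "continuous_on {0..t} R"
proof -
  have "continuous_on {0..t} A"
    unfolding A_def
    by (intro indefinite_integral_continuous_1 integrable_continuous_real continuous_B)
  then have "continuous_on {0..t} (\<lambda>t. R 0 - t powr (2 * H) / 2 + lam\<^sup>2 * A t)"
    using H by (intro continuous_intros continuous_on_powr') auto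
  then show ?thesis
    by (rule continuous_on_eq) (rule R_eq[symmetric], simp)
qed

lemma DERIV_B: "0 < t \<Longrightarrow> (B has_real_derivative R t) (at t)"
  \<comment> \<open>On the longer interval up to \<open>t + 1\<close> the point \<open>t\<close> is
    interior, so the derivative within the interval is two-sided.\<close>
  using integral_has_real_derivative[OF continuous_R[of "t + 1"], of t]
  by (simp add: B_def[abs_def] at_within_Icc_at)

lemma DERIV_A: "0 < t \<Longrightarrow> (A has_real_derivative B t) (at t)"
  using integral_has_real_derivative[OF continuous_B[of "t + 1"], of t]
  by (simp add: A_def[abs_def] at_within_Icc_at)

text \<open>The result of differentiating the right-hand side of the integral equation once.\<close>

definition dR where "dR t = lam\<^sup>2 * B t - H * t powr (2 * H - 1)"

lemma DERIV_R:
  assumes t: "0 < t"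
  shows "(R has_real_derivative dR t) (at t)"
proof -
  have "((\<lambda>t. R 0 - t powr (2 * H) / 2 + lam\<^sup>2 * A t) has_real_derivative dR t) (at t)"
    using t by (auto intro!: derivative_eq_intros DERIV_A simp: dR_def)
  \<comment> \<open>The integral equation is available only for nonnegative times, so it is used on
    a neighbourhood of \<open>t\<close> inside the positive half-line.\<close>
  moreover have "eventually (\<lambda>s. s \<in> {0<..}) (nhds t)"
    by (rule eventually_nhds_in_open) (use t in auto)
  then have "eventually (\<lambda>s. R s = R 0 - s powr (2 * H) / 2 + lam\<^sup>2 * A s) (nhds t)"
    by eventually_elim (rule R_eq, simp)
  ultimately show ?thesis
    by (subst DERIV_cong_ev[OF refl _ refl])
qed

text \<open>The covariance solves \<open>R'' = \<lambda>\<^sup>2 R - c t powr (2 H - 2)\<close>. The factorisation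
  \<open>(D - \<lambda>) (D + \<lambda>)\<close> turns this into two first-order equations, with \<open>U = R' + \<lambda> R\<close>.\<close>

definition U where "U t = dR t + lam * R t"

lemma DERIV_U:
  assumes t: "0 < t"
  shows "(U has_real_derivative lam * U t - H * (2 * H - 1) * t powr (2 * H - 2)) (at t)"
  unfolding U_def dR_def using t
  by (auto intro!: derivative_eq_intros DERIV_B DERIV_R simp: dR_def algebra_simps power2_eq_square)

section \<open>Asymptotics of the first-order equations at infinity\<close>

text \<open>This excludes the solution of the equation for \<open>U\<close> that grows like
  \<open>exp (lam * t)\<close>: since \<open>R\<close> is bounded, \<open>B\<close> grows at most
  linearly, so \<open>U\<close> grows at most polynomially.\<close>

lemma exp_U_tendsto: "((\<lambda>t. exp (- lam * t) * U t) \<longlongrightarrow> 0) at_top"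
proof (rule Lim_null_comparison)
  show "eventually (\<lambda>t. norm (exp (- lam * t) * U t) \<le>
      exp (- lam * t) * (lam\<^sup>2 * (C * t) + H * t powr (2 * H - 1) + lam * C)) at_top"
    using eventually_ge_at_top[of 0]
  proof eventually_elim
    case (elim t)
    have "\<bar>U t\<bar> \<le> \<bar>lam\<^sup>2 * B t\<bar> + \<bar>H * t powr (2 * H - 1)\<bar> + \<bar>lam * R t\<bar>"
      unfolding U_def dR_def by linarith
    also have "\<dots> \<le> lam\<^sup>2 * (C * t) + H * t powr (2 * H - 1) + lam * C"
      using elim abs_B_le[of t] bounded[of t] H lam
      by (intro add_mono) (simp_all add: abs_mult)
    finally show ?case by (simp add: abs_mult)
  qed
  show "((\<lambda>t. exp (- lam * t) * (lam\<^sup>2 * (C * t) + H * t powr (2 * H - 1) + lam * C)) \<longlongrightarrow> 0) at_top"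
    using lam H by real_asymp
qed

text \<open>With the integrating factor \<open>exp (- lam * t)\<close> the derivative of the
  numerator no longer contains \<open>U\<close>. Numerator and denominator both vanish at infinity,
  so the 0/0 form of l'Hopital's rule applies.\<close>

lemma U_tendsto:
  "((\<lambda>t. U t / t powr (2 * H - 2)) \<longlongrightarrow> H * (2 * H - 1) / lam) at_top"
proof -
  let ?c = "H * (2 * H - 1)" and ?p = "2 * H - 2"
  have "((\<lambda>t. (exp (- lam * t) * U t) / (exp (- lam * t) * t powr ?p)) \<longlongrightarrow> ?c / lam) at_top"
  proof (rule lhopital_at_top_0)
    show "((\<lambda>t. exp (- lam * t) * t powr ?p) \<longlongrightarrow> 0) at_top"
      using lam by real_asymp
    show "eventually (\<lambda>t. exp (- lam * t) * t powr ?p \<noteq> 0) at_top"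
      using eventually_gt_at_top[of 0] by eventually_elim auto
    let ?g' = "\<lambda>t. exp (- lam * t) * (?p * t powr (?p - 1) - lam * t powr ?p)"
    let ?f' = "\<lambda>t. exp (- lam * t) * (- ?c * t powr ?p)"
    show "eventually (\<lambda>t. ((\<lambda>t. exp (- lam * t) * U t) has_real_derivative ?f' t) (at t)) at_top"
      using eventually_gt_at_top[of 0]
      by eventually_elim (auto intro!: derivative_eq_intros DERIV_U simp: algebra_simps)
    show "eventually (\<lambda>t. ((\<lambda>t. exp (- lam * t) * t powr ?p) has_real_derivative ?g' t) (at t)) at_top"
      using eventually_gt_at_top[of 0]
      by eventually_elim (auto intro!: derivative_eq_intros simp: algebra_simps)
    \<comment> \<open>Factoring out \<open>t powr ?p\<close> lets it cancel against the same power
      in \<open>?f'\<close>.\<close>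
    have eq: "?g' t = exp (- lam * t) * (?p / t - lam) * t powr ?p" if "t > 0" for t
    proof -
      have "t powr (?p - 1) = t powr ?p / t"
        using that by (subst powr_diff) auto
      then show ?thesis
        unfolding \<open>t powr (?p - 1) = t powr ?p / t\<close> by (simp add: algebra_simps)
    qed
    show "eventually (\<lambda>t. ?g' t \<noteq> 0) at_top"
      using eventually_gt_at_top[of 0]
    proof eventually_elim
      case (elim t)
      then have "?p / t < 0" using H by (simp add: divide_neg_pos)
      then show ?case using eq[OF elim] elim lam by auto
    qed
    have "((\<lambda>t. - ?c / (?p / t - lam)) \<longlongrightarrow> ?c / lam) at_top"
    proof (rule tendsto_eq_rhs)
      show "((\<lambda>t. - ?c / (?p / t - lam)) \<longlongrightarrow> - ?c / (0 - lam)) at_top"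
        using lam
        by (intro tendsto_divide tendsto_diff tendsto_const
              real_tendsto_divide_at_top[OF tendsto_const] filterlim_ident) auto
    qed simp
    moreover have "eventually (\<lambda>t. - ?c / (?p / t - lam) = ?f' t / ?g' t) at_top"
      using eventually_gt_at_top[of 0]
      by eventually_elim (subst eq, simp_all)
    ultimately show "((\<lambda>t. ?f' t / ?g' t) \<longlongrightarrow> ?c / lam) at_top"
      by (rule Lim_transform_eventually)
  qed (rule exp_U_tendsto)
  then show ?thesis by simp
qed

text \<open>Here \<open>R' + lam * R = U\<close> is treated with the opposite integrating factor
  \<open>exp (lam * t)\<close>. The denominator now diverges, and this form of l'Hopital's rule asks
  for no limit of the numerator. The second division by \<open>lam\<close> produces the square in
  the constant.\<close>

lemma R_tendsto:
  "((\<lambda>t. R t / t powr (2 * H - 2)) \<longlongrightarrow> H * (2 * H - 1) / lam\<^sup>2) at_top"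
proof -
  let ?c = "H * (2 * H - 1)" and ?p = "2 * H - 2"
  have "((\<lambda>t. (exp (lam * t) * R t) / (exp (lam * t) * t powr ?p)) \<longlongrightarrow> ?c / lam\<^sup>2) at_top"
  proof (rule lhospital_at_top_at_top)
    show "filterlim (\<lambda>t. exp (lam * t) * t powr ?p) at_top at_top"
      using lam by real_asymp
    let ?g' = "\<lambda>t. exp (lam * t) * (?p * t powr (?p - 1) + lam * t powr ?p)"
    let ?f' = "\<lambda>t. exp (lam * t) * U t"
    show "eventually (\<lambda>t. ((\<lambda>t. exp (lam * t) * R t) has_real_derivative ?f' t) (at t)) at_top"
      using eventually_gt_at_top[of 0]
      by eventually_elim (auto intro!: derivative_eq_intros DERIV_R simp: algebra_simps U_def)
    show "eventually (\<lambda>t. ((\<lambda>t. exp (lam * t) * t powr ?p) has_real_derivative ?g' t) (at t)) at_top"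
      using eventually_gt_at_top[of 0]
      by eventually_elim (auto intro!: derivative_eq_intros simp: algebra_simps)
    have eq: "?g' t = exp (lam * t) * ((?p / t + lam) * t powr ?p)" if "t > 0" for t
    proof -
      have "t powr (?p - 1) = t powr ?p / t"
        using that by (subst powr_diff) auto
      then show ?thesis
        unfolding \<open>t powr (?p - 1) = t powr ?p / t\<close> by (simp add: algebra_simps)
    qed
    have "((\<lambda>t. ?p / t + lam) \<longlongrightarrow> 0 + lam) at_top"
      by (intro tendsto_add tendsto_const real_tendsto_divide_at_top[OF tendsto_const] filterlim_ident)
    then have lim: "((\<lambda>t. ?p / t + lam) \<longlongrightarrow> lam) at_top"
      by simp
    \<comment> \<open>The factor \<open>?p / t + lam\<close> is negative for small \<open>t\<close>,
      because \<open>?p < 0\<close>; it is positive only from some time on.\<close>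
    show "eventually (\<lambda>t. ?g' t \<noteq> 0) at_top"
      using eventually_gt_at_top[of 0] order_tendstoD(1)[OF lim lam]
      by eventually_elim (subst eq, simp_all)
    have "((\<lambda>t. U t / t powr ?p / (?p / t + lam)) \<longlongrightarrow> ?c / lam\<^sup>2) at_top"
      using tendsto_divide[OF U_tendsto lim] lam by (simp add: power2_eq_square)
    moreover have "eventually (\<lambda>t. U t / t powr ?p / (?p / t + lam) = ?f' t / ?g' t) at_top"
      using eventually_gt_at_top[of 0]
      by eventually_elim (subst eq, simp_all add: mult.commute)
    ultimately show "((\<lambda>t. ?f' t / ?g' t) \<longlongrightarrow> ?c / lam\<^sup>2) at_top"
      by (rule Lim_transform_eventually)
  qed
  then show ?thesis by simp
qed

text \<open>Dividing by the limit requires it to be nonzero, which is where \<open>H = 1 / 2\<close>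
  is excluded.\<close>

lemma asymp_at_top:
  assumes "H \<noteq> 1 / 2"
  shows "R \<sim>[at_top] (\<lambda>t. H * (2 * H - 1) / lam\<^sup>2 * t powr (2 * H - 2))"
proof -
  define k where "k = H * (2 * H - 1) / lam\<^sup>2"
  have k: "k \<noteq> 0"
    using assms H lam by (auto simp: k_def)
  have "((\<lambda>t. R t / t powr (2 * H - 2) / k) \<longlongrightarrow> k / k) at_top"
    by (intro tendsto_divide R_tendsto[folded k_def] tendsto_const k)
  then have "((\<lambda>t. R t / (k * t powr (2 * H - 2))) \<longlongrightarrow> 1) at_top"
    using k by (simp add: mult.commute)
  then show ?thesis
    unfolding k_def by (rule asymp_equivI')
qed

text \<open>By the integral equation the increment is
  \<open>t powr (2 * H) / 2 - lam^2 * A t\<close>, and \<open>A t\<close>, being of order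
  \<open>t^2\<close>, is negligible because \<open>H < 1\<close>.\<close>

lemma asymp_at_0:
  "((\<lambda>t. (R 0 - R t) / (1 / 2 * \<bar>t\<bar> powr (2 * H))) \<longlongrightarrow> 1) (at_right 0)"
proof -
  have lim: "((\<lambda>t. A t / t powr (2 * H)) \<longlongrightarrow> 0) (at_right 0)"
  proof (rule Lim_null_comparison)
    show "eventually (\<lambda>t. norm (A t / t powr (2 * H)) \<le> C * t powr (2 - 2 * H)) (at_right 0)"
      using eventually_at_right_less[of 0]
    proof eventually_elim
      case (elim t)
      then have "\<bar>A t\<bar> / t powr (2 * H) \<le> C * t * t / t powr (2 * H)"
        using abs_A_le[of t] by (intro divide_right_mono) auto
      also have "\<dots> = C * t powr (2 - 2 * H)"
        using elim by (simp add: powr_diff power2_eq_square)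
      finally show ?case by simp
    qed
    show "((\<lambda>t. C * t powr (2 - 2 * H)) \<longlongrightarrow> 0) (at_right 0)"
      using H by real_asymp
  qed
  have "((\<lambda>t. 1 - 2 * lam\<^sup>2 * (A t / t powr (2 * H))) \<longlongrightarrow> 1) (at_right 0)"
    using tendsto_diff[OF tendsto_const[of 1] tendsto_mult[OF tendsto_const[of "2 * lam\<^sup>2"] lim]]
    by simp
  moreover have "eventually (\<lambda>t. 1 - 2 * lam\<^sup>2 * (A t / t powr (2 * H)) =
      (R 0 - R t) / (1 / 2 * \<bar>t\<bar> powr (2 * H))) (at_right 0)"
    using eventually_at_right_less[of 0]
  proof eventually_elim
    case (elim t)
    then have "R 0 - R t = t powr (2 * H) / 2 - lam\<^sup>2 * A t"
      using R_eq[of t] by linarith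
    then show ?case
      using elim by (simp add: field_simps)
  qed
  ultimately show ?thesis
    by (rule Lim_transform_eventually)
qed

end

section \<open>Continuous processes and square integrability\<close>

lemma floor_grid_tendsto: "(\<lambda>n. real_of_int \<lfloor>real (Suc n) * s\<rfloor> / real (Suc n)) \<longlonglongrightarrow> s"
proof (rule LIMSEQ_I)
  fix r :: real assume "0 < r"
  then obtain n0 where n0: "inverse (real (Suc n0)) < r"
    using reals_Archimedean by blast
  have "norm (real_of_int \<lfloor>real (Suc n) * s\<rfloor> / real (Suc n) - s) < r" if "n \<ge> n0" for n
  proof -
    have "\<bar>real_of_int \<lfloor>real (Suc n) * s\<rfloor> - real (Suc n) * s\<bar> \<le> 1"
      by linarith
    then have "\<bar>real_of_int \<lfloor>real (Suc n) * s\<rfloor> - real (Suc n) * s\<bar> / real (Suc n) \<le> 1 / real (Suc n)"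
      by (rule divide_right_mono) simp
    moreover have "real_of_int \<lfloor>real (Suc n) * s\<rfloor> / real (Suc n) - s =
        (real_of_int \<lfloor>real (Suc n) * s\<rfloor> - real (Suc n) * s) / real (Suc n)"
      by (simp add: field_simps del: of_nat_Suc)
    moreover have "1 / real (Suc n) \<le> inverse (real (Suc n0))"
      using that by (simp add: field_simps)
    ultimately show ?thesis
      using n0 by (simp add: abs_divide del: of_nat_Suc)
  qed
  then show "\<exists>no. \<forall>n\<ge>no. norm (real_of_int \<lfloor>real (Suc n) * s\<rfloor> / real (Suc n) - s) < r"
    by blast
qed

text \<open>Rounding the time down to a grid leaves countably many random variables at each stage,
  so the approximations are jointly measurable. Path continuity gives pointwise convergence.\<close>

lemma borel_measurable_continuous_process:
  fixes V :: "real \<Rightarrow> 'a \<Rightarrow> real"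
  assumes meas: "\<And>s. V s \<in> borel_measurable M"
    and cont: "\<And>\<omega>. \<omega> \<in> space M \<Longrightarrow> continuous_on UNIV (\<lambda>s. V s \<omega>)"
  shows "(\<lambda>p. V (fst p) (snd p)) \<in> borel_measurable (borel \<Otimes>\<^sub>M M)"
proof (rule borel_measurable_LIMSEQ_real)
  let ?u = "\<lambda>n p. V (real_of_int \<lfloor>real (Suc n) * fst p\<rfloor> / real (Suc n)) (snd p)"
  show "?u n \<in> borel_measurable (borel \<Otimes>\<^sub>M M)" for n
  proof (rule measurable_compose_countable[where f = "\<lambda>i p. V (real_of_int i / real (Suc n)) (snd p)"
        and g = "\<lambda>p. \<lfloor>real (Suc n) * fst p\<rfloor>"])
    show "(\<lambda>p. V (real_of_int i / real (Suc n)) (snd p)) \<in> borel_measurable (borel \<Otimes>\<^sub>M M)" for i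
      by (rule measurable_compose[OF measurable_snd meas])
  qed measurable
  show "(\<lambda>n. ?u n p) \<longlonglongrightarrow> V (fst p) (snd p)" if "p \<in> space (borel \<Otimes>\<^sub>M M)" for p
    using continuous_on_tendsto_compose[OF cont floor_grid_tendsto[of "fst p"], of "snd p"] that
    by (auto simp: space_pair_measure)
qed

text \<open>Fubini's theorem: the uniform bound on first absolute moments over a bounded time
  interval gives integrability on the product space. The rest translates between Lebesgue and gauge
  integrals.\<close>

lemma (in prob_space) expectation_integral_continuous_process:
  fixes V :: "real \<Rightarrow> 'a \<Rightarrow> real"
  assumes t: "0 \<le> t"
    and int: "\<And>s. 0 \<le> s \<Longrightarrow> s \<le> t \<Longrightarrow> integrable M (V s)"
    and bound: "\<And>s. 0 \<le> s \<Longrightarrow> s \<le> t \<Longrightarrow> expectation (\<lambda>\<omega>. \<bar>V s \<omega>\<bar>) \<le> C"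
    and cont: "\<And>\<omega>. \<omega> \<in> space M \<Longrightarrow> continuous_on {0..t} (\<lambda>s. V s \<omega>)"
  shows "integrable M (\<lambda>\<omega>. integral {0..t} (\<lambda>s. V s \<omega>))"
    and "(\<lambda>s. expectation (V s)) integrable_on {0..t}"
    and "expectation (\<lambda>\<omega>. integral {0..t} (\<lambda>s. V s \<omega>)) = integral {0..t} (\<lambda>s. expectation (V s))"
proof -
  \<comment> \<open>Clamping the time to \<open>{0..t}\<close> makes the paths continuous on the
    whole line, as joint measurability requires, without changing the values on the
    interval.\<close>
  define W where "W s = V (max 0 (min s t))" for s
  define L :: "real measure" where "L = restrict_space lborel {0..t}"
  have W: "W s = V s" if "s \<in> {0..t}" for s
    using that by (simp add: W_def)
  have space_L: "space L = {0..t}"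
    by (simp add: L_def space_restrict_space)
  interpret L: finite_measure L
    by (rule finite_measureI) (use t in \<open>simp add: L_def emeasure_restrict_space space_restrict_space\<close>)
  interpret P: pair_sigma_finite L M ..
  have W_int: "integrable M (W s)" for s
    unfolding W_def using t by (intro int) auto
  have "continuous_on UNIV (\<lambda>s. W s \<omega>)" if "\<omega> \<in> space M" for \<omega>
    unfolding W_def
    by (rule continuous_on_compose2[OF cont[OF that]]) (use t in \<open>auto intro!: continuous_intros\<close>)
  then have "(\<lambda>p. W (fst p) (snd p)) \<in> borel_measurable (borel \<Otimes>\<^sub>M M)"
    using W_int by (intro borel_measurable_continuous_process) auto
  moreover have "(\<lambda>p. (fst p, snd p)) \<in> L \<Otimes>\<^sub>M M \<rightarrow>\<^sub>M borel \<Otimes>\<^sub>M M"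
  proof (rule measurable_Pair)
    have "(\<lambda>x. x) \<in> L \<rightarrow>\<^sub>M borel"
      unfolding L_def by (rule measurable_restrict_space1) simp
    then show "fst \<in> L \<Otimes>\<^sub>M M \<rightarrow>\<^sub>M borel"
      using measurable_compose[OF measurable_fst] by blast
  qed simp
  ultimately have W_meas: "(\<lambda>(s, \<omega>). W s \<omega>) \<in> borel_measurable (L \<Otimes>\<^sub>M M)"
    using measurable_compose by (fastforce simp: case_prod_beta')
  have "(\<lambda>s. \<integral>\<omega>. norm (W s \<omega>) \<partial>M) \<in> borel_measurable L"
    using W_meas by measurable
  moreover have "expectation (\<lambda>\<omega>. \<bar>W s \<omega>\<bar>) \<le> C" for s
    unfolding W_def using t by (intro bound) auto
  ultimately have "integrable L (\<lambda>s. \<integral>\<omega>. norm (W s \<omega>) \<partial>M)"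
    by (intro L.integrable_const_bound[of _ C]) (auto intro!: AE_I2)
  then have I: "integrable (L \<Otimes>\<^sub>M M) (\<lambda>(s, \<omega>). W s \<omega>)"
    using W_meas W_int by (intro P.Fubini_integrable) auto
  have L_integral: "integral\<^sup>L L g = integral {0..t} g \<and> g integrable_on {0..t}"
    if g: "integrable L g" for g :: "real \<Rightarrow> real"
  proof -
    have "set_integrable lborel {0..t} g"
      using g by (simp add: L_def integrable_restrict_space set_integrable_def)
    then show ?thesis
      using set_borel_integral_eq_integral[of "{0..t}" g]
      by (simp add: L_def integral_restrict_space set_lebesgue_integral_def)
  qed
  have pw: "integral\<^sup>L L (\<lambda>s. W s \<omega>) = integral {0..t} (\<lambda>s. V s \<omega>)" if "\<omega> \<in> space M" for \<omega>
  proof -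
    have "continuous_on {0..t} (\<lambda>s. W s \<omega>)"
      using cont[OF that] by (rule continuous_on_eq) (simp add: W)
    then have "set_integrable lborel {0..t} (\<lambda>s. W s \<omega>)"
      unfolding set_integrable_def by (intro borel_integrable_compact) auto
    then have "integrable L (\<lambda>s. W s \<omega>)"
      by (simp add: L_def integrable_restrict_space set_integrable_def)
    then have "integral\<^sup>L L (\<lambda>s. W s \<omega>) = integral {0..t} (\<lambda>s. W s \<omega>)"
      using L_integral by blast
    also have "\<dots> = integral {0..t} (\<lambda>s. V s \<omega>)"
      by (rule integral_cong) (simp add: W)
    finally show ?thesis .
  qed
  have "integrable M (\<lambda>\<omega>. integral\<^sup>L L (\<lambda>s. W s \<omega>))"
    using P.integrable_snd[OF I] .
  then show "integrable M (\<lambda>\<omega>. integral {0..t} (\<lambda>s. V s \<omega>))"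
    by (rule Bochner_Integration.integrable_cong[THEN iffD1, rotated 2]) (auto simp: pw)
  have E: "integral\<^sup>L L (\<lambda>s. expectation (W s)) = integral {0..t} (\<lambda>s. expectation (W s)) \<and>
      (\<lambda>s. expectation (W s)) integrable_on {0..t}"
    by (rule L_integral[OF P.integrable_fst[OF I]])
  then show "(\<lambda>s. expectation (V s)) integrable_on {0..t}"
    by (subst integrable_cong[of _ _ "\<lambda>s. expectation (W s)"]) (auto simp: W)
  have "expectation (\<lambda>\<omega>. integral {0..t} (\<lambda>s. V s \<omega>)) = expectation (\<lambda>\<omega>. integral\<^sup>L L (\<lambda>s. W s \<omega>))"
    by (rule Bochner_Integration.integral_cong) (auto simp: pw)
  also have "\<dots> = integral {0..t} (\<lambda>s. expectation (W s))"
    using P.Fubini_integral[OF I] E by simp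
  also have "\<dots> = integral {0..t} (\<lambda>s. expectation (V s))"
    by (rule integral_cong) (simp add: W)
  finally show "expectation (\<lambda>\<omega>. integral {0..t} (\<lambda>s. V s \<omega>)) = integral {0..t} (\<lambda>s. expectation (V s))" .
qed

section \<open>Square integrability from a contraction in law\<close>

text \<open>Taking expectations in \<open>le\<close> directly would be vacuous for an infinite
  second moment, so \<open>h K\<close> is the moment truncated at level \<open>K\<close>. Equality
  in law gives a recursion from level \<open>K\<close> to level \<open>K / b\<close>; iterating it
  bounds \<open>h\<close> uniformly, and monotone convergence concludes.\<close>

lemma (in prob_space) square_integrable_contraction:
  fixes X Y Q :: "'a \<Rightarrow> real"
  assumes [measurable]: "X \<in> borel_measurable M" "Y \<in> borel_measurable M"
    and distr: "distr M borel Y = distr M borel X"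
    and Q: "integrable M Q" "\<And>\<omega>. \<omega> \<in> space M \<Longrightarrow> 0 \<le> Q \<omega>"
    and b: "0 < b" "b < 1"
    and le: "\<And>\<omega>. \<omega> \<in> space M \<Longrightarrow> (Y \<omega>)\<^sup>2 \<le> b * (X \<omega>)\<^sup>2 + Q \<omega>"
  shows "integrable M (\<lambda>\<omega>. (X \<omega>)\<^sup>2)"
proof -
  define h where "h K = expectation (\<lambda>\<omega>. min ((X \<omega>)\<^sup>2) K)" for K
  \<comment> \<open>\<open>D\<close> is the fixed point of \<open>x = b * x + expectation Q\<close>;
    subtracting it makes the recursion homogeneous.\<close>
  define D where "D = expectation Q / (1 - b)"
  have min_int: "integrable M (\<lambda>\<omega>. min (c * (Z \<omega>)\<^sup>2) K)"
    if "0 \<le> K" "0 \<le> c" "Z \<in> borel_measurable M" for c K and Z :: "'a \<Rightarrow> real"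
    using that by (intro integrable_const_bound[of _ K]) (auto intro!: AE_I2)
  have step: "h K - D \<le> b * (h (K / b) - D)" if "0 < K" for K
  proof -
    have "h K = (\<integral>x. min (x\<^sup>2) K \<partial>distr M borel X)"
      by (simp add: h_def integral_distr)
    also have "\<dots> = expectation (\<lambda>\<omega>. min ((Y \<omega>)\<^sup>2) K)"
      unfolding distr[symmetric] by (simp add: integral_distr)
    also have "\<dots> \<le> expectation (\<lambda>\<omega>. b * min ((X \<omega>)\<^sup>2) (K / b) + Q \<omega>)"
    proof (rule integral_mono)
      show "integrable M (\<lambda>\<omega>. min ((Y \<omega>)\<^sup>2) K)"
        using min_int[of K 1 Y] that by simp
      show "integrable M (\<lambda>\<omega>. b * min ((X \<omega>)\<^sup>2) (K / b) + Q \<omega>)"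
        using min_int[of "K / b" 1 X] that b Q by simp
      show "min ((Y \<omega>)\<^sup>2) K \<le> b * min ((X \<omega>)\<^sup>2) (K / b) + Q \<omega>" if "\<omega> \<in> space M" for \<omega>
        using le[OF that] Q(2)[OF that] b by (auto simp: min_def field_simps)
    qed
    also have "\<dots> = b * h (K / b) + expectation Q"
      using min_int[of "K / b" 1 X] that b Q by (simp add: h_def)
    also have "expectation Q = (1 - b) * D"
      using b by (simp add: D_def)
    finally show ?thesis
      by (simp add: algebra_simps)
  qed
  have iter: "h K - D \<le> b ^ n * (h (K / b ^ n) - D)" if "0 < K" for K n
    using that
  proof (induction n arbitrary: K)
    case (Suc n)
    have "h K - D \<le> b * (h (K / b) - D)"
      by (rule step) fact
    also have "\<dots> \<le> b * (b ^ n * (h (K / b / b ^ n) - D))"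
      using Suc.IH[of "K / b"] Suc.prems b by (intro mult_left_mono) auto
    finally show ?case
      by (simp add: mult.assoc)
  qed simp
  have h_le: "h K \<le> D" if K: "0 < K" for K
  proof -
    \<comment> \<open>The truncation level \<open>K / b ^ n\<close> grows, but moving
      \<open>b ^ n\<close> inside the minimum restores the fixed level \<open>K\<close>. The
      constant \<open>K\<close> then dominates, and the expectations tend to 0.\<close>
    have scale: "b ^ n * h (K / b ^ n) = expectation (\<lambda>\<omega>. min (b ^ n * (X \<omega>)\<^sup>2) K)" for n
    proof -
      have "b ^ n * min ((X \<omega>)\<^sup>2) (K / b ^ n) = min (b ^ n * (X \<omega>)\<^sup>2) K" for \<omega>
        using b by (auto simp: min_def field_simps)
      then show ?thesis
        by (simp add: h_def flip: integral_mult_right_zero)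
    qed
    have bn: "(\<lambda>n. b ^ n) \<longlonglongrightarrow> 0"
      using b by (intro LIMSEQ_power_zero) auto
    have "(\<lambda>n. expectation (\<lambda>\<omega>. min (b ^ n * (X \<omega>)\<^sup>2) K)) \<longlonglongrightarrow> expectation (\<lambda>\<omega>. 0)"
    proof (rule integral_dominated_convergence[where w = "\<lambda>_. K"])
      show "AE \<omega> in M. (\<lambda>n. min (b ^ n * (X \<omega>)\<^sup>2) K) \<longlonglongrightarrow> 0"
      proof (rule AE_I2)
        fix \<omega>
        have "(\<lambda>n. min (b ^ n * (X \<omega>)\<^sup>2) K) \<longlonglongrightarrow> min (0 * (X \<omega>)\<^sup>2) K"
          by (intro tendsto_min tendsto_mult bn tendsto_const)
        then show "(\<lambda>n. min (b ^ n * (X \<omega>)\<^sup>2) K) \<longlonglongrightarrow> 0"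
          using K by simp
      qed
    qed (use K b in auto)
    then have "(\<lambda>n. b ^ n * h (K / b ^ n) - b ^ n * D) \<longlonglongrightarrow> 0 - 0 * D"
      unfolding scale[symmetric] by (intro tendsto_diff tendsto_mult bn tendsto_const) simp
    then have "h K - D \<le> 0"
      using iter[OF K] by (intro LIMSEQ_le_const[where X = "\<lambda>n. b ^ n * h (K / b ^ n) - b ^ n * D"])
        (auto simp: algebra_simps)
    then show ?thesis by simp
  qed
  have mono: "h (real m) \<le> h (real n)" if "m \<le> n" for m n
    unfolding h_def using that min_int[of _ 1 X] by (intro integral_mono) auto
  obtain l where l: "(\<lambda>n. h (real n)) \<longlonglongrightarrow> l"
  proof (rule incseq_convergent)
    show "incseq (\<lambda>n. h (real n))"
      using mono by (auto simp: incseq_def)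
    \<comment> \<open>The bound \<open>h_le\<close> needs a positive level, so level 0 is covered by
      passing to the successor.\<close>
    have "h (real n) \<le> D" for n
      using mono[of n "Suc n"] h_le[of "real (Suc n)"] by auto
    then show "\<forall>n. h (real n) \<le> D" ..
  qed
  show ?thesis
  proof (rule integrable_monotone_convergence)
    show "integrable M (\<lambda>\<omega>. min ((X \<omega>)\<^sup>2) (real n))" for n
      using min_int[of "real n" 1 X] by simp
    show "AE \<omega> in M. mono (\<lambda>n. min ((X \<omega>)\<^sup>2) (real n))"
      by (auto intro!: AE_I2 monoI min.mono)
    show "AE \<omega> in M. (\<lambda>n. min ((X \<omega>)\<^sup>2) (real n)) \<longlonglongrightarrow> (X \<omega>)\<^sup>2"
    proof (rule AE_I2)
      fix \<omega>
      obtain n0 where "(X \<omega>)\<^sup>2 \<le> real n0"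
        using real_arch_simple by blast
      then have "eventually (\<lambda>n. (X \<omega>)\<^sup>2 = min ((X \<omega>)\<^sup>2) (real n)) sequentially"
        unfolding eventually_sequentially by (intro exI[of _ n0]) auto
      then show "(\<lambda>n. min ((X \<omega>)\<^sup>2) (real n)) \<longlonglongrightarrow> (X \<omega>)\<^sup>2"
        by (rule Lim_transform_eventually[OF tendsto_const])
    qed
    show "(\<lambda>n. expectation (\<lambda>\<omega>. min ((X \<omega>)\<^sup>2) (real n))) \<longlonglongrightarrow> l"
      using l by (simp add: h_def)
  qed simp
qed

text \<open>Jensen's inequality on the unit interval, obtained by integrating
  \<open>(f s - c)^2\<close>, where \<open>c\<close> is the mean of \<open>f\<close>.\<close>

lemma integral_power2_le:
  fixes f :: "real \<Rightarrow> real"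
  assumes "continuous_on {0..1} f"
  shows "(integral {0..1} f)\<^sup>2 \<le> integral {0..1} (\<lambda>s. (f s)\<^sup>2)"
proof -
  define c where "c = integral {0..1} f"
  have f: "(f has_integral c) {0..1}"
    unfolding c_def by (intro integrable_integral integrable_continuous_real assms)
  have f2: "((\<lambda>s. (f s)\<^sup>2) has_integral integral {0..1} (\<lambda>s. (f s)\<^sup>2)) {0..1}"
    by (intro integrable_integral integrable_continuous_real continuous_intros assms)
  have "((\<lambda>s. (f s)\<^sup>2 - 2 * c * f s + c\<^sup>2) has_integral
      integral {0..1} (\<lambda>s. (f s)\<^sup>2) - 2 * c * c + c\<^sup>2) {0..1}"
    using has_integral_const_real[of "c\<^sup>2" 0 1]
    by (intro has_integral_add has_integral_diff has_integral_mult_right f f2) simp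
  then have "0 \<le> integral {0..1} (\<lambda>s. (f s)\<^sup>2) - 2 * c * c + c\<^sup>2"
  proof (rule has_integral_nonneg)
    show "0 \<le> (f s)\<^sup>2 - 2 * c * f s + c\<^sup>2" for s
      using zero_le_power2[of "f s - c"] by (simp add: power2_diff algebra_simps)
  qed
  then show ?thesis
    by (simp add: c_def power2_eq_square)
qed

text \<open>Variation of constants for a single path. The integrating factor is applied to the
  primitive of \<open>x\<close>, so no derivative of \<open>n\<close> occurs. The final bound uses
  \<open>(u + v)^2 \<le> 2 * u^2 + 2 * v^2\<close>.\<close>

lemma langevin_contraction:
  fixes x n :: "real \<Rightarrow> real"
  assumes lam: "0 < lam"
    and x: "continuous_on {0..1} x" and n: "continuous_on {0..1} n"
    and eq: "\<And>t. 0 \<le> t \<Longrightarrow> t \<le> 1 \<Longrightarrow> x t = x 0 - lam * integral {0..t} x + n t"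
  shows "(x 1 - exp (- lam) * x 0)\<^sup>2 \<le> 2 * (n 1)\<^sup>2 + 2 * lam\<^sup>2 * integral {0..1} (\<lambda>s. (n s)\<^sup>2)"
proof -
  \<comment> \<open>The subtracted term is the integral of \<open>exp (lam * s) * x 0\<close> over
    \<open>{0..t}\<close>; without it the derivative would be
    \<open>exp (lam * t) * (x 0 + n t)\<close>.\<close>
  define G where "G t = exp (lam * t) * integral {0..t} x - x 0 * (exp (lam * t) - 1) / lam" for t
  have "((\<lambda>s. exp (lam * s) * n s) has_integral (G 1 - G 0)) {0..1}"
  proof (rule fundamental_theorem_of_calculus)
    fix t :: real assume t: "t \<in> {0..1}"
    have "(G has_real_derivative
        lam * exp (lam * t) * integral {0..t} x + exp (lam * t) * x t - x 0 * exp (lam * t))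
        (at t within {0..1})"
      unfolding G_def using lam
      by (auto intro!: derivative_eq_intros integral_has_real_derivative[OF x t] simp: field_simps)
    also have "lam * exp (lam * t) * integral {0..t} x + exp (lam * t) * x t - x 0 * exp (lam * t) =
        exp (lam * t) * (lam * integral {0..t} x + x t - x 0)"
      by (simp add: algebra_simps)
    also have "lam * integral {0..t} x + x t - x 0 = n t"
      using eq[of t] t by simp
    finally show "(G has_vector_derivative exp (lam * t) * n t) (at t within {0..1})"
      by (simp add: has_real_derivative_iff_has_vector_derivative)
  qed simp
  then have G1: "G 1 = integral {0..1} (\<lambda>s. exp (lam * s) * n s)"
    by (simp add: G_def integral_unique)
  have "(G 1)\<^sup>2 \<le> integral {0..1} (\<lambda>s. (exp (lam * s) * n s)\<^sup>2)"
    unfolding G1 by (intro integral_power2_le continuous_intros n)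
  \<comment> \<open>The crude bound \<open>exp (lam * s) \<le> exp lam\<close> costs nothing, since
    this factor is cancelled by \<open>exp (- lam)\<close> at the end.\<close>
  also have "\<dots> \<le> integral {0..1} (\<lambda>s. (exp lam)\<^sup>2 * (n s)\<^sup>2)"
  proof (rule integral_le)
    show "(exp (lam * s) * n s)\<^sup>2 \<le> (exp lam)\<^sup>2 * (n s)\<^sup>2" if "s \<in> {0..1}" for s
      unfolding power_mult_distrib using that lam
      by (intro mult_right_mono power_mono) (auto simp: mult_le_cancel_left2)
  qed (auto intro!: integrable_continuous_real continuous_intros n)
  finally have G2: "(G 1)\<^sup>2 \<le> (exp lam)\<^sup>2 * integral {0..1} (\<lambda>s. (n s)\<^sup>2)"
    by simp
  have e: "exp (- lam) * exp lam = 1"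
    by (simp flip: exp_add)
  have "exp (- lam) * G 1 = (exp (- lam) * exp lam) * integral {0..1} x -
      x 0 * (exp (- lam) * exp lam - exp (- lam)) / lam"
    by (simp add: G_def algebra_simps diff_divide_distrib)
  then have "exp (- lam) * G 1 = integral {0..1} x - x 0 * (1 - exp (- lam)) / lam"
    unfolding e by simp
  then have "lam * (exp (- lam) * G 1) = lam * (integral {0..1} x - x 0 * (1 - exp (- lam)) / lam)"
    by (rule arg_cong)
  also have "\<dots> = lam * integral {0..1} x - x 0 * (1 - exp (- lam))"
    using lam by (simp add: field_simps)
  finally have "x 1 - exp (- lam) * x 0 = n 1 - lam * exp (- lam) * G 1"
    using eq[of 1] by (simp add: algebra_simps)
  then have "(x 1 - exp (- lam) * x 0)\<^sup>2 \<le> 2 * (n 1)\<^sup>2 + 2 * (lam * exp (- lam) * G 1)\<^sup>2"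
    using sum_squares_bound[of "n 1" "- (lam * exp (- lam) * G 1)"] by (simp add: power2_diff)
  also have "(lam * exp (- lam) * G 1)\<^sup>2 = lam\<^sup>2 * ((exp (- lam))\<^sup>2 * (G 1)\<^sup>2)"
    by (simp add: power_mult_distrib)
  also have "\<dots> \<le> lam\<^sup>2 * ((exp (- lam))\<^sup>2 * ((exp lam)\<^sup>2 * integral {0..1} (\<lambda>s. (n s)\<^sup>2)))"
    by (intro mult_left_mono G2) auto
  also have "\<dots> = lam\<^sup>2 * integral {0..1} (\<lambda>s. (n s)\<^sup>2)"
    by (simp add: exp_minus field_simps)
  finally show ?thesis
    by simp
qed

section \<open>The Langevin equation with continuous paths\<close>

text \<open>Both parts come from \<open>2 * \<bar>y * z\<bar> \<le> y^2 + z^2\<close>. The second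
  part supplies the uniform moment bounds for Fubini's theorem.\<close>

lemma (in prob_space) integrable_mult_square_integrable:
  fixes Y Z :: "'a \<Rightarrow> real"
  assumes [measurable]: "Y \<in> borel_measurable M" "Z \<in> borel_measurable M"
    and int: "integrable M (\<lambda>\<omega>. (Y \<omega>)\<^sup>2)" "integrable M (\<lambda>\<omega>. (Z \<omega>)\<^sup>2)"
  shows "integrable M (\<lambda>\<omega>. Y \<omega> * Z \<omega>)"
    and "expectation (\<lambda>\<omega>. \<bar>Y \<omega> * Z \<omega>\<bar>) \<le>
      (expectation (\<lambda>\<omega>. (Y \<omega>)\<^sup>2) + expectation (\<lambda>\<omega>. (Z \<omega>)\<^sup>2)) / 2"
proof -
  have le: "\<bar>Y \<omega> * Z \<omega>\<bar> \<le> ((Y \<omega>)\<^sup>2 + (Z \<omega>)\<^sup>2) / 2" for \<omega>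
    using sum_squares_bound[of "\<bar>Y \<omega>\<bar>" "\<bar>Z \<omega>\<bar>"] by (simp add: abs_mult)
  have sum: "integrable M (\<lambda>\<omega>. ((Y \<omega>)\<^sup>2 + (Z \<omega>)\<^sup>2) / 2)"
    using int by simp
  show I: "integrable M (\<lambda>\<omega>. Y \<omega> * Z \<omega>)"
  proof (rule Bochner_Integration.integrable_bound[OF sum])
    show "AE \<omega> in M. norm (Y \<omega> * Z \<omega>) \<le> norm (((Y \<omega>)\<^sup>2 + (Z \<omega>)\<^sup>2) / 2)"
      unfolding real_norm_def by (intro AE_I2 order_trans[OF le abs_ge_self])
  qed simp
  show "expectation (\<lambda>\<omega>. \<bar>Y \<omega> * Z \<omega>\<bar>) \<le>
      (expectation (\<lambda>\<omega>. (Y \<omega>)\<^sup>2) + expectation (\<lambda>\<omega>. (Z \<omega>)\<^sup>2)) / 2"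
    using integral_mono[OF integrable_abs[OF I] sum le] int by simp
qed

lemma (in prob_space) integrable_square_integrable:
  fixes Y :: "'a \<Rightarrow> real"
  assumes "Y \<in> borel_measurable M" "integrable M (\<lambda>\<omega>. (Y \<omega>)\<^sup>2)"
  shows "integrable M Y" "expectation (\<lambda>\<omega>. \<bar>Y \<omega>\<bar>) \<le> (expectation (\<lambda>\<omega>. (Y \<omega>)\<^sup>2) + 1) / 2"
  using integrable_mult_square_integrable[of Y "\<lambda>_. 1"] assms by (simp_all add: prob_space)

lemma has_integral_reflect_Icc:
  fixes f :: "real \<Rightarrow> real"
  assumes "(f has_integral i) {0..t}"
  shows "((\<lambda>s. f (t - s)) has_integral i) {0..t}"
proof -
  have "((\<lambda>s. f (- s)) has_integral i) {- t..- 0}"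
    using assms by (subst has_integral_reflect_real)
  from has_integral_shift_real_ivl[OF this, of "- t"] show ?thesis
    by simp
qed

text \<open>The setting once a null set has been removed: paths are continuous and solve the
  equation everywhere. The identity \<open>X_covariance\<close> compares integrals determined by the
  joint law, so it can be stated before \<open>X 0\<close> is known to be square integrable.\<close>

locale langevin = prob_space M for M :: "'a measure" +
  fixes N X :: "real \<Rightarrow> 'a \<Rightarrow> real" and H lam :: real
  assumes H: "0 < H" "H < 1" and lam: "0 < lam"
    and N_measurable [measurable]: "\<And>t. N t \<in> borel_measurable M"
    and X_measurable [measurable]: "\<And>t. X t \<in> borel_measurable M"
    and continuous_N: "\<omega> \<in> space M \<Longrightarrow> continuous_on {0..t} (\<lambda>t. N t \<omega>)"
    and continuous_X: "\<omega> \<in> space M \<Longrightarrow> continuous_on {0..t} (\<lambda>t. X t \<omega>)"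
    and langevin_eq: "\<omega> \<in> space M \<Longrightarrow> 0 \<le> t \<Longrightarrow>
      X t \<omega> = X 0 \<omega> - lam * integral {0..t} (\<lambda>s. X s \<omega>) + N t \<omega>"
    and N_square_integrable: "0 \<le> t \<Longrightarrow> integrable M (\<lambda>\<omega>. (N t \<omega>)\<^sup>2)"
    and N_mean: "0 \<le> t \<Longrightarrow> expectation (N t) = 0"
    and N_variance: "0 \<le> t \<Longrightarrow> expectation (\<lambda>\<omega>. (N t \<omega>)\<^sup>2) = t powr (2 * H)"
    and X_distr: "0 \<le> t \<Longrightarrow> distr M borel (X t) = distr M borel (X 0)"
    and X_covariance: "0 \<le> s \<Longrightarrow> s \<le> t \<Longrightarrow>
      expectation (\<lambda>\<omega>. X t \<omega> * X s \<omega>) = expectation (\<lambda>\<omega>. X (t - s) \<omega> * X 0 \<omega>)"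
begin

text \<open>Writing \<open>X 1 = a * X 0 + (1 - a) * u\<close> as a convex combination and using
  convexity of the square gives the hypothesis of the contraction lemma with factor
  \<open>a\<close>; this is the origin of the division by \<open>1 - a\<close> in
  \<open>Q\<close>.\<close>

lemma X_0_square_integrable: "integrable M (\<lambda>\<omega>. (X 0 \<omega>)\<^sup>2)"
proof -
  define a where "a = exp (- lam)"
  have a: "0 < a" "a < 1"
    using lam by (auto simp: a_def)
  define Q where "Q \<omega> = (2 * (N 1 \<omega>)\<^sup>2 + 2 * lam\<^sup>2 * integral {0..1} (\<lambda>s. (N s \<omega>)\<^sup>2)) / (1 - a)" for \<omega>
  show ?thesis
  proof (rule square_integrable_contraction[where Y = "X 1" and Q = Q and b = a])
    have "integrable M (\<lambda>\<omega>. integral {0..1} (\<lambda>s. (N s \<omega>)\<^sup>2))"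
    proof (rule expectation_integral_continuous_process(1)[where C = 1])
      show "expectation (\<lambda>\<omega>. \<bar>(N s \<omega>)\<^sup>2\<bar>) \<le> 1" if "0 \<le> s" "s \<le> 1" for s
        using that H N_variance[of s] powr_mono2[of "2 * H" s 1] by simp
    qed (auto intro!: N_square_integrable continuous_intros continuous_N)
    then show "integrable M Q"
      unfolding Q_def using N_square_integrable[of 1] by simp
    show "0 \<le> Q \<omega>" if "\<omega> \<in> space M" for \<omega>
      unfolding Q_def using a
      by (intro divide_nonneg_nonneg add_nonneg_nonneg mult_nonneg_nonneg integral_nonneg
            integrable_continuous_real continuous_intros continuous_N that) auto
    show "(X 1 \<omega>)\<^sup>2 \<le> a * (X 0 \<omega>)\<^sup>2 + Q \<omega>" if \<omega>: "\<omega> \<in> space M" for \<omega>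
    proof -
      define w where "w = X 1 \<omega> - a * X 0 \<omega>"
      have "w\<^sup>2 \<le> 2 * (N 1 \<omega>)\<^sup>2 + 2 * lam\<^sup>2 * integral {0..1} (\<lambda>s. (N s \<omega>)\<^sup>2)"
        unfolding w_def a_def
        by (rule langevin_contraction[OF lam continuous_X continuous_N langevin_eq])
          (use \<omega> in auto)
      then have "w\<^sup>2 / (1 - a) \<le> Q \<omega>"
        unfolding Q_def using a by (intro divide_right_mono) auto
      moreover have "(a * X 0 \<omega> + w)\<^sup>2 \<le> a * (X 0 \<omega>)\<^sup>2 + w\<^sup>2 / (1 - a)"
      proof -
        define u where "u = w / (1 - a)"
        have w: "w = (1 - a) * u"
          using a by (simp add: u_def)
        have "0 \<le> a * (1 - a) * (X 0 \<omega> - u)\<^sup>2"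
          using a by simp
        also have "\<dots> = a * (X 0 \<omega>)\<^sup>2 + (1 - a) * u\<^sup>2 - (a * X 0 \<omega> + (1 - a) * u)\<^sup>2"
          by (simp add: power2_eq_square algebra_simps)
        also have "(1 - a) * u\<^sup>2 = w\<^sup>2 / (1 - a)"
          using a by (simp add: w power2_eq_square)
        finally show ?thesis by (simp flip: w)
      qed
      ultimately show ?thesis
        by (simp add: w_def)
    qed
  qed (use a X_distr[of 1] in auto)
qed

section \<open>Moments of the stationary solution and of its time integral\<close>

lemma
  fixes f :: "real \<Rightarrow> real"
  assumes t: "0 \<le> t" and f: "f \<in> borel_measurable borel"
  shows X_integrable_iff: "integrable M (\<lambda>\<omega>. f (X t \<omega>)) \<longleftrightarrow> integrable M (\<lambda>\<omega>. f (X 0 \<omega>))"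
    and X_expectation_eq: "expectation (\<lambda>\<omega>. f (X t \<omega>)) = expectation (\<lambda>\<omega>. f (X 0 \<omega>))"
  unfolding integrable_distr_eq[OF X_measurable f, symmetric] integral_distr[OF X_measurable f, symmetric]
    X_distr[OF t] by (rule refl)+

lemma X_square_integrable: "0 \<le> t \<Longrightarrow> integrable M (\<lambda>\<omega>. (X t \<omega>)\<^sup>2)"
  by (subst X_integrable_iff[where f = "\<lambda>x. x\<^sup>2"]) (auto intro: X_0_square_integrable)

lemma X_second_moment: "0 \<le> t \<Longrightarrow> expectation (\<lambda>\<omega>. (X t \<omega>)\<^sup>2) = expectation (\<lambda>\<omega>. (X 0 \<omega>)\<^sup>2)"
  by (rule X_expectation_eq) auto

lemma X_mean_eq: "0 \<le> t \<Longrightarrow> expectation (X t) = expectation (X 0)"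
  using X_expectation_eq[of t "\<lambda>x. x"] by simp

lemma X_integrable: "0 \<le> t \<Longrightarrow> integrable M (X t)"
  by (rule integrable_square_integrable(1)[OF X_measurable X_square_integrable])

definition I where "I t \<omega> = integral {0..t} (\<lambda>s. X s \<omega>)"

text \<open>Solving the equation for the integral turns \<open>I t\<close> into a linear combination
  of three random variables, from which its measurability and second moment bound can be read
  off.\<close>

lemma I_eq: "\<omega> \<in> space M \<Longrightarrow> 0 \<le> t \<Longrightarrow> I t \<omega> = (X 0 \<omega> - X t \<omega> + N t \<omega>) / lam"
  using langevin_eq[of \<omega> t] lam by (simp add: I_def field_simps)

lemma I_measurable: "0 \<le> t \<Longrightarrow> I t \<in> borel_measurable M"
  by (subst measurable_cong[OF I_eq]) auto

text \<open>By Fubini and stationarity \<open>I 1\<close> has the mean of \<open>X 0\<close>,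
  whereas the Langevin equation gives it mean 0.\<close>

lemma X_mean:
  assumes t: "0 \<le> t"
  shows "expectation (X t) = 0"
proof -
  have N_int: "integrable M (N 1)"
    by (rule integrable_square_integrable(1)[OF N_measurable N_square_integrable]) simp
  have "expectation (\<lambda>\<omega>. integral {0..1} (\<lambda>s. X s \<omega>)) = integral {0..1} (\<lambda>s. expectation (X s))"
  proof (rule expectation_integral_continuous_process)
    show "expectation (\<lambda>\<omega>. \<bar>X s \<omega>\<bar>) \<le> (expectation (\<lambda>\<omega>. (X 0 \<omega>)\<^sup>2) + 1) / 2" if "0 \<le> s" for s
      using integrable_square_integrable(2)[OF X_measurable X_square_integrable[OF that]]
      by (simp add: X_second_moment[OF that])
  qed (auto intro!: X_integrable continuous_X)
  also have "\<dots> = integral {0..1} (\<lambda>s::real. expectation (X 0))"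
    by (rule Henstock_Kurzweil_Integration.integral_cong) (rule X_mean_eq, simp)
  finally have "expectation (I 1) = expectation (X 0)"
    by (simp add: I_def[abs_def])
  also have "expectation (I 1) = expectation (\<lambda>\<omega>. (X 0 \<omega> - X 1 \<omega> + N 1 \<omega>) / lam)"
    by (rule Bochner_Integration.integral_cong) (auto simp: I_eq)
  also have "\<dots> = 0"
    using X_integrable[of 0] X_integrable[of 1] N_int by (simp add: X_mean_eq[of 1] N_mean)
  finally show ?thesis
    by (simp add: X_mean_eq[OF t])
qed

text \<open>The uncentered product moment; it is the covariance because the means vanish.\<close>

definition R where "R t = expectation (\<lambda>\<omega>. X t \<omega> * X 0 \<omega>)"

lemma R_0: "R 0 = expectation (\<lambda>\<omega>. (X 0 \<omega>)\<^sup>2)"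
  by (simp add: R_def power2_eq_square)

lemma XX_integrable: "0 \<le> s \<Longrightarrow> 0 \<le> t \<Longrightarrow> integrable M (\<lambda>\<omega>. X s \<omega> * X t \<omega>)"
  by (intro integrable_mult_square_integrable X_square_integrable) auto

lemma XX_abs_le: "0 \<le> s \<Longrightarrow> 0 \<le> t \<Longrightarrow> expectation (\<lambda>\<omega>. \<bar>X s \<omega> * X t \<omega>\<bar>) \<le> R 0"
  using integrable_mult_square_integrable(2)[of "X s" "X t"]
  by (simp add: X_square_integrable X_second_moment[of s] X_second_moment[of t] R_0)

lemma abs_R_le: "0 \<le> t \<Longrightarrow> \<bar>R t\<bar> \<le> R 0"
  unfolding R_def[of t] using XX_abs_le[of t 0] integral_abs_bound[of M "\<lambda>\<omega>. X t \<omega> * X 0 \<omega>"]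
  by linarith

lemma expectation_X_integral:
  assumes s: "0 \<le> s" and t: "0 \<le> t"
  shows "(\<lambda>u. expectation (\<lambda>\<omega>. X s \<omega> * X u \<omega>)) integrable_on {0..t}"
    and "expectation (\<lambda>\<omega>. X s \<omega> * I t \<omega>) = integral {0..t} (\<lambda>u. expectation (\<lambda>\<omega>. X s \<omega> * X u \<omega>))"
proof -
  note F = expectation_integral_continuous_process[where V = "\<lambda>u \<omega>. X s \<omega> * X u \<omega>" and C = "R 0", OF t]
  show "(\<lambda>u. expectation (\<lambda>\<omega>. X s \<omega> * X u \<omega>)) integrable_on {0..t}"
    by (rule F(2)) (auto intro!: XX_integrable XX_abs_le s continuous_intros continuous_X)
  have "expectation (\<lambda>\<omega>. integral {0..t} (\<lambda>u. X s \<omega> * X u \<omega>)) =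
      integral {0..t} (\<lambda>u. expectation (\<lambda>\<omega>. X s \<omega> * X u \<omega>))"
    by (rule F(3)) (auto intro!: XX_integrable XX_abs_le s continuous_intros continuous_X)
  then show "expectation (\<lambda>\<omega>. X s \<omega> * I t \<omega>) = integral {0..t} (\<lambda>u. expectation (\<lambda>\<omega>. X s \<omega> * X u \<omega>))"
    by (simp add: I_def)
qed

lemma R_integrable_on: "R integrable_on {0..t}"
proof (cases "0 \<le> t")
  case True
  from expectation_X_integral(1)[OF order_refl this] show ?thesis
    by (simp add: R_def[abs_def] mult.commute)
qed auto

lemma expectation_X0_I: "0 \<le> t \<Longrightarrow> expectation (\<lambda>\<omega>. X 0 \<omega> * I t \<omega>) = integral {0..t} R"
  using expectation_X_integral(2)[of 0 t] by (simp add: R_def[abs_def] mult.commute)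

text \<open>Stationarity turns the integrand into \<open>R (t - u)\<close>, and reflecting the
  interval removes the shift. The value agrees with that of \<open>expectation_X0_I\<close>.\<close>

lemma expectation_X_I:
  assumes t: "0 \<le> t"
  shows "expectation (\<lambda>\<omega>. X t \<omega> * I t \<omega>) = integral {0..t} R"
proof -
  have "expectation (\<lambda>\<omega>. X t \<omega> * I t \<omega>) = integral {0..t} (\<lambda>u. expectation (\<lambda>\<omega>. X t \<omega> * X u \<omega>))"
    by (rule expectation_X_integral(2)[OF t t])
  also have "\<dots> = integral {0..t} (\<lambda>u. R (t - u))"
    by (rule Henstock_Kurzweil_Integration.integral_cong) (auto simp only: R_def atLeastAtMost_iff intro!: X_covariance)
  also have "\<dots> = integral {0..t} R"
    by (rule integral_unique[OF has_integral_reflect_Icc[OF integrable_integral[OF R_integrable_on]]])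
  finally show ?thesis .
qed

lemma I_square_integrable:
  assumes t: "0 \<le> t"
  shows "integrable M (\<lambda>\<omega>. (I t \<omega>)\<^sup>2)"
    and "expectation (\<lambda>\<omega>. (I t \<omega>)\<^sup>2) \<le> (6 * R 0 + 3 * t powr (2 * H)) / lam\<^sup>2"
proof -
  let ?S = "\<lambda>\<omega>. (3 * (X 0 \<omega>)\<^sup>2 + 3 * (X t \<omega>)\<^sup>2 + 3 * (N t \<omega>)\<^sup>2) / lam\<^sup>2"
  have S: "integrable M ?S"
    using X_square_integrable[OF t] X_0_square_integrable N_square_integrable[OF t] by simp
  have le: "(I t \<omega>)\<^sup>2 \<le> ?S \<omega>" if "\<omega> \<in> space M" for \<omega>
  proof -
    \<comment> \<open>The difference of the two sides is
      \<open>(x + y)^2 + (y + z)^2 + (x - z)^2\<close>.\<close>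
    have "(x - y + z)\<^sup>2 \<le> 3 * x\<^sup>2 + 3 * y\<^sup>2 + 3 * z\<^sup>2" for x y z :: real
      using zero_le_power2[of "x + y"] zero_le_power2[of "y + z"] zero_le_power2[of "x - z"]
      by (simp add: power2_eq_square algebra_simps)
    then show ?thesis
      using lam by (simp add: I_eq[OF that t] power_divide divide_right_mono)
  qed
  show int: "integrable M (\<lambda>\<omega>. (I t \<omega>)\<^sup>2)"
  proof (rule Bochner_Integration.integrable_bound[OF S])
    show "AE \<omega> in M. norm ((I t \<omega>)\<^sup>2) \<le> norm (?S \<omega>)"
      unfolding real_norm_def abs_power2 by (intro AE_I2 order_trans[OF le abs_ge_self])
  qed (use I_measurable[OF t] in simp)
  have "expectation (\<lambda>\<omega>. (I t \<omega>)\<^sup>2) \<le> expectation ?S"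
    by (rule integral_mono[OF int S le])
  also have "expectation ?S = (6 * R 0 + 3 * t powr (2 * H)) / lam\<^sup>2"
    using X_square_integrable[OF t] X_0_square_integrable N_square_integrable[OF t]
    by (simp add: X_second_moment[OF t] N_variance[OF t] R_0)
  finally show "expectation (\<lambda>\<omega>. (I t \<omega>)\<^sup>2) \<le> (6 * R 0 + 3 * t powr (2 * H)) / lam\<^sup>2" .
qed

lemma continuous_I: "\<omega> \<in> space M \<Longrightarrow> continuous_on {0..t} (\<lambda>s. I s \<omega>)"
  unfolding I_def by (intro indefinite_integral_continuous_1 integrable_continuous_real continuous_X)

text \<open>Pathwise \<open>I\<^sup>2 = \<integral> 2 X I\<close>; this yields the double integral of \<open>R\<close> as an iterated primitive,
  the form in which it can be differentiated directly.\<close>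

lemma I_second_moment:
  assumes t: "0 \<le> t"
  shows "expectation (\<lambda>\<omega>. (I t \<omega>)\<^sup>2) = 2 * integral {0..t} (\<lambda>s. integral {0..s} R)"
proof -
  \<comment> \<open>Half the sum of the second moment of \<open>X s\<close> and the bound for that
    of \<open>I s\<close>, the latter taken at the final time \<open>t\<close> to be uniform in
    \<open>s\<close>.\<close>
  let ?C = "(R 0 + (6 * R 0 + 3 * t powr (2 * H)) / lam\<^sup>2) / 2"
  have path: "(I t \<omega>)\<^sup>2 = 2 * integral {0..t} (\<lambda>s. X s \<omega> * I s \<omega>)" if \<omega>: "\<omega> \<in> space M" for \<omega>
  proof -
    have "((\<lambda>s. 2 * (X s \<omega> * I s \<omega>)) has_integral ((I t \<omega>)\<^sup>2 - (I 0 \<omega>)\<^sup>2)) {0..t}"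
    proof (rule fundamental_theorem_of_calculus[OF t])
      fix s assume s: "s \<in> {0..t}"
      have "((\<lambda>s. I s \<omega>) has_real_derivative X s \<omega>) (at s within {0..t})"
        unfolding I_def by (rule integral_has_real_derivative[OF continuous_X[OF \<omega>] s])
      then have "((\<lambda>s. (I s \<omega>)\<^sup>2) has_real_derivative 2 * (X s \<omega> * I s \<omega>)) (at s within {0..t})"
        by (auto intro!: derivative_eq_intros)
      then show "((\<lambda>s. (I s \<omega>)\<^sup>2) has_vector_derivative 2 * (X s \<omega> * I s \<omega>)) (at s within {0..t})"
        by (simp add: has_real_derivative_iff_has_vector_derivative)
    qed
    from integral_unique[OF this] show ?thesis
      by (simp add: I_def)
  qed
  have "expectation (\<lambda>\<omega>. integral {0..t} (\<lambda>s. X s \<omega> * I s \<omega>)) =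
      integral {0..t} (\<lambda>s. expectation (\<lambda>\<omega>. X s \<omega> * I s \<omega>))"
  proof (rule expectation_integral_continuous_process[OF t, where C = ?C])
    fix s assume s: "0 \<le> s" "s \<le> t"
    note XI = integrable_mult_square_integrable[OF X_measurable I_measurable[OF s(1)]
        X_square_integrable[OF s(1)] I_square_integrable(1)[OF s(1)]]
    show "integrable M (\<lambda>\<omega>. X s \<omega> * I s \<omega>)"
      by (rule XI)
    have "s powr (2 * H) \<le> t powr (2 * H)"
      using s H by (intro powr_mono2) auto
    then have "(6 * R 0 + 3 * s powr (2 * H)) / lam\<^sup>2 \<le> (6 * R 0 + 3 * t powr (2 * H)) / lam\<^sup>2"
      by (intro divide_right_mono) auto
    then have "expectation (\<lambda>\<omega>. (I s \<omega>)\<^sup>2) \<le> (6 * R 0 + 3 * t powr (2 * H)) / lam\<^sup>2"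
      using I_square_integrable(2)[OF s(1)] by linarith
    then show "expectation (\<lambda>\<omega>. \<bar>X s \<omega> * I s \<omega>\<bar>) \<le> ?C"
      using XI(2) by (simp add: X_second_moment[OF s(1)] R_0)
  qed (intro continuous_intros continuous_X continuous_I)
  also have "\<dots> = integral {0..t} (\<lambda>s. integral {0..s} R)"
    by (rule Henstock_Kurzweil_Integration.integral_cong) (simp add: expectation_X_I)
  finally show ?thesis
    by (subst Bochner_Integration.integral_cong[OF refl path]) auto
qed

text \<open>Square \<open>N t = X t - X 0 + lam * I t\<close> and take expectations. The cross terms
  of \<open>I t\<close> with \<open>X t\<close> and with \<open>X 0\<close> have equal expectations
  and opposite signs, so they cancel.\<close>

lemma R_volterra:
  assumes t: "0 \<le> t"
  shows "R t = R 0 - t powr (2 * H) / 2 + lam\<^sup>2 * integral {0..t} (\<lambda>s. integral {0..s} R)"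
proof -
  note int = X_square_integrable[OF t] X_0_square_integrable I_square_integrable(1)[OF t]
    XX_integrable[OF t order_refl]
    integrable_mult_square_integrable(1)[OF X_measurable I_measurable[OF t]
      X_square_integrable[OF t] I_square_integrable(1)[OF t]]
    integrable_mult_square_integrable(1)[OF X_measurable I_measurable[OF t]
      X_0_square_integrable I_square_integrable(1)[OF t]]
  have "t powr (2 * H) = expectation (\<lambda>\<omega>. (N t \<omega>)\<^sup>2)"
    by (simp add: N_variance[OF t])
  also have "\<dots> = expectation (\<lambda>\<omega>. (X t \<omega>)\<^sup>2 + (X 0 \<omega>)\<^sup>2 + lam\<^sup>2 * (I t \<omega>)\<^sup>2 - 2 * (X t \<omega> * X 0 \<omega>) +
      2 * lam * (X t \<omega> * I t \<omega>) - 2 * lam * (X 0 \<omega> * I t \<omega>))"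
  proof (rule Bochner_Integration.integral_cong[OF refl])
    fix \<omega> assume "\<omega> \<in> space M"
    then have N: "N t \<omega> = X t \<omega> - X 0 \<omega> + lam * I t \<omega>"
      using lam by (simp add: I_eq[OF _ t])
    show "(N t \<omega>)\<^sup>2 = (X t \<omega>)\<^sup>2 + (X 0 \<omega>)\<^sup>2 + lam\<^sup>2 * (I t \<omega>)\<^sup>2 - 2 * (X t \<omega> * X 0 \<omega>) +
        2 * lam * (X t \<omega> * I t \<omega>) - 2 * lam * (X 0 \<omega> * I t \<omega>)"
      unfolding N by (simp add: power2_eq_square algebra_simps)
  qed
  also have "\<dots> = 2 * R 0 + lam\<^sup>2 * (2 * integral {0..t} (\<lambda>s. integral {0..s} R)) - 2 * R t"
    using int
    by (simp add: X_second_moment[OF t] I_second_moment[OF t] expectation_X_I[OF t]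
        expectation_X0_I[OF t] flip: R_0 R_def)
  finally show ?thesis
    by linarith
qed

sublocale langevin_covariance R H lam "R 0"
  using H lam abs_R_le R_integrable_on R_volterra by unfold_locales

lemma covariance_eq_R: "0 \<le> t \<Longrightarrow> covariance M (X t) (X 0) = R t"
  by (simp add: covariance_def X_mean R_def)

end

section \<open>Stationarity and continuous modifications\<close>

lemma stationary_process_distr:
  assumes X: "stationary_process M X" and J: "finite J"
    and f: "f \<in> borel_measurable (Pi\<^sub>M J (\<lambda>_. borel))"
  shows "distr M borel (\<lambda>\<omega>. f (\<lambda>t\<in>J. X (t + h) \<omega>)) = distr M borel (\<lambda>\<omega>. f (\<lambda>t\<in>J. X t \<omega>))"
proof -
  have [measurable]: "X t \<in> borel_measurable M" for t
    using X by (simp add: stationary_process_def real_process_def)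
  have m: "(\<lambda>\<omega>. \<lambda>t\<in>J. X (t + h) \<omega>) \<in> M \<rightarrow>\<^sub>M Pi\<^sub>M J (\<lambda>_. borel)" for h
    by measurable
  have "distr M (Pi\<^sub>M J (\<lambda>_. borel)) (\<lambda>\<omega>. \<lambda>t\<in>J. X (t + h) \<omega>) =
      distr M (Pi\<^sub>M J (\<lambda>_. borel)) (\<lambda>\<omega>. \<lambda>t\<in>J. X t \<omega>)"
    using X J by (simp add: stationary_process_def same_fdd_def)
  then show ?thesis
    using distr_distr[OF f m[of h]] distr_distr[OF f m[of 0]] by (simp add: comp_def)
qed

lemma stationary_process_distr1:
  assumes X: "stationary_process M X"
  shows "distr M borel (X t) = distr M borel (X 0)"
  using stationary_process_distr[OF X, of "{0}" "\<lambda>x. x 0" t] by simp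

text \<open>Both integrals are determined by the law of the pair, so no integrability is assumed.
  The constants allow for centered covariances as well as raw product moments.\<close>

lemma stationary_process_expectation_mult:
  assumes X: "stationary_process M X"
  shows "integral\<^sup>L M (\<lambda>\<omega>. (X (s + h) \<omega> - a) * (X (t + h) \<omega> - b)) =
    integral\<^sup>L M (\<lambda>\<omega>. (X s \<omega> - a) * (X t \<omega> - b))"
proof -
  have [measurable]: "X t \<in> borel_measurable M" for t
    using X by (simp add: stationary_process_def real_process_def)
  have "distr M borel (\<lambda>\<omega>. (X (s + h) \<omega> - a) * (X (t + h) \<omega> - b)) =
      distr M borel (\<lambda>\<omega>. (X s \<omega> - a) * (X t \<omega> - b))"
    using stationary_process_distr[OF X, of "{s, t}" "\<lambda>x. (x s - a) * (x t - b)" h] by simp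
  then have "integral\<^sup>L (distr M borel (\<lambda>\<omega>. (X (s + h) \<omega> - a) * (X (t + h) \<omega> - b))) (\<lambda>x. x) =
      integral\<^sup>L (distr M borel (\<lambda>\<omega>. (X s \<omega> - a) * (X t \<omega> - b))) (\<lambda>x. x)"
    by simp
  then show ?thesis
    by (subst (asm) (1 2) integral_distr) auto
qed

text \<open>Shifting the pair of times \<open>- t\<close> and \<open>0\<close> by \<open>t\<close>
  gives \<open>0\<close> and \<open>t\<close>, and the product is symmetric.\<close>

lemma autocov_minus:
  assumes X: "stationary_process M X"
  shows "autocov M X (- t) = autocov M X t"
proof -
  have [measurable]: "X t \<in> borel_measurable M" for t
    using X by (simp add: stationary_process_def real_process_def)
  have mean: "integral\<^sup>L M (X t) = integral\<^sup>L M (X 0)" for t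
  proof -
    have "integral\<^sup>L M (X t) = integral\<^sup>L (distr M borel (X t)) (\<lambda>x. x)"
      by (subst integral_distr) auto
    also have "\<dots> = integral\<^sup>L (distr M borel (X 0)) (\<lambda>x. x)"
      by (subst stationary_process_distr1[OF X]) (rule refl)
    also have "\<dots> = integral\<^sup>L M (X 0)"
      by (subst integral_distr) auto
    finally show ?thesis .
  qed
  show ?thesis
    unfolding autocov_def covariance_def mean[of t] mean[of "- t"]
    using stationary_process_expectation_mult[OF X, of "- t" t "integral\<^sup>L M (X 0)" 0 "integral\<^sup>L M (X 0)"]
    by (simp add: mult.commute)
qed

section \<open>Removal of the exceptional null set\<close>

text \<open>On the good event the equation itself makes \<open>X\<close> continuous, as an
  indefinite integral plus a continuous path. Off that event both processes are set to zero, which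
  preserves all laws and moments.\<close>

lemma QOU_continuous_modification:
  assumes fBm: "fractional_Brownian_motion M H N" and QOU: "QOU_process M lam N X"
  obtains N' X' where "langevin M N' X' H lam" "\<And>t. AE \<omega> in M. X' t \<omega> = X t \<omega>"
proof -
  have X: "stationary_process M X" and lam: "0 < lam"
    using QOU by (auto simp: QOU_process_def)
  interpret prob_space M
    using X by (simp add: stationary_process_def real_process_def)
  have X_meas [measurable]: "X t \<in> borel_measurable M" for t
    using X by (simp add: stationary_process_def real_process_def)
  have N_meas [measurable]: "N t \<in> borel_measurable M" for t
    using fBm by (simp add: fractional_Brownian_motion_def gaussian_process_def real_process_def)
  let ?P = "\<lambda>\<omega>. continuous_on UNIV (\<lambda>t. N t \<omega>) \<and>
    (\<forall>t::real. interval_lebesgue_integrable lborel (ereal 0) (ereal t) (\<lambda>s. X s \<omega>) \<and>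
      X t \<omega> = X 0 \<omega> - lam * (LBINT s=ereal 0..ereal t. X s \<omega>) + N t \<omega>)"
  have "AE \<omega> in M. ?P \<omega>"
    using fBm QOU unfolding fractional_Brownian_motion_def QOU_process_def by auto
  \<comment> \<open>The set of bad outcomes need not be measurable, so a measurable null set
    containing it is used.\<close>
  then obtain Z where Z: "{\<omega> \<in> space M. \<not> ?P \<omega>} \<subseteq> Z" "emeasure M Z = 0" "Z \<in> sets M"
    by (rule AE_E)
  define G where "G = space M - Z"
  have G [measurable]: "G \<in> sets M"
    using Z by (auto simp: G_def)
  have AE_G: "AE \<omega> in M. \<omega> \<in> G"
    using AE_not_in[of Z M] Z AE_space by (auto simp: G_def null_sets_def)
  have path: "?P \<omega>" if "\<omega> \<in> G" for \<omega>
    using Z(1) that unfolding G_def by blast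
  have cont_N: "continuous_on UNIV (\<lambda>t. N t \<omega>)" if "\<omega> \<in> G" for \<omega>
    using path[OF that] by blast
  \<comment> \<open>The zero path together with zero noise solves the Langevin equation, so the
    equation holds for every outcome.\<close>
  define N' where "N' t \<omega> = (if \<omega> \<in> G then N t \<omega> else 0)" for t \<omega>
  define X' where "X' t \<omega> = (if \<omega> \<in> G then X t \<omega> else 0)" for t \<omega>
  have N'_meas [measurable]: "N' t \<in> borel_measurable M" for t
    unfolding N'_def by measurable
  have X'_meas [measurable]: "X' t \<in> borel_measurable M" for t
    unfolding X'_def by measurable
  have AE_N': "AE \<omega> in M. N' t \<omega> = N t \<omega>" for t
    using AE_G by eventually_elim (simp add: N'_def)
  have AE_X': "AE \<omega> in M. X' t \<omega> = X t \<omega>" for t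
    using AE_G by eventually_elim (simp add: X'_def)
  \<comment> \<open>For nonnegative times the oriented Lebesgue integral over the open interval is
    the gauge integral over \<open>{0..t}\<close>.\<close>
  have eq: "(\<lambda>s. X s \<omega>) integrable_on {0..t}"
    "X t \<omega> = X 0 \<omega> - lam * integral {0..t} (\<lambda>s. X s \<omega>) + N t \<omega>"
    if \<omega>: "\<omega> \<in> G" and t: "0 \<le> t" for \<omega> t
  proof -
    have "interval_lebesgue_integrable lborel (ereal 0) (ereal t) (\<lambda>s. X s \<omega>)"
      using path[OF \<omega>] by blast
    then have int: "set_integrable lborel (einterval (ereal 0) (ereal t)) (\<lambda>s. X s \<omega>)"
      using t by (simp add: interval_lebesgue_integrable_def)
    show "(\<lambda>s. X s \<omega>) integrable_on {0..t}"
      using set_borel_integral_eq_integral(1)[OF int] by (simp add: integrable_on_open_interval_real)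
    have LBINT: "(LBINT s=ereal 0..ereal t. X s \<omega>) = integral {0..t} (\<lambda>s. X s \<omega>)"
      using interval_integral_eq_integral'[OF _ int] t by (simp add: integral_open_interval_real)
    have "X t \<omega> = X 0 \<omega> - lam * (LBINT s=ereal 0..ereal t. X s \<omega>) + N t \<omega>"
      using path[OF \<omega>] by blast
    then show "X t \<omega> = X 0 \<omega> - lam * integral {0..t} (\<lambda>s. X s \<omega>) + N t \<omega>"
      unfolding LBINT .
  qed
  have mean: "integral\<^sup>L M (N t) = 0" for t
    using fBm by (simp add: fractional_Brownian_motion_def)
  have var: "expectation (\<lambda>\<omega>. (N t \<omega>)\<^sup>2) = \<bar>t\<bar> powr (2 * H)" for t
  proof -
    have "covariance M (N t) (N t) = \<bar>t\<bar> powr (2 * H)"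
      using fBm by (simp add: fractional_Brownian_motion_def)
    then show ?thesis
      by (simp add: covariance_def mean power2_eq_square)
  qed
  \<comment> \<open>The total integral is 0 for a nonintegrable function, so the nonzero variance
    forces integrability when \<open>t\<close> is nonzero. At \<open>t = 0\<close> the variable
    vanishes almost everywhere.\<close>
  have N_int: "integrable M (\<lambda>\<omega>. (N t \<omega>)\<^sup>2)" for t
  proof (cases "t = 0")
    case True
    have "AE \<omega> in M. (N t \<omega>)\<^sup>2 = 0"
      using fBm True by (auto simp: fractional_Brownian_motion_def)
    then show ?thesis
      by (subst integrable_cong_AE[where g = "\<lambda>_. 0"]) auto
  next
    case False
    then show ?thesis
      using var[of t] not_integrable_integral_eq by fastforce
  qed
  have "langevin M N' X' H lam"
  proof unfold_locales
    show "0 < H" "H < 1"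
      using fBm by (auto simp: fractional_Brownian_motion_def)
    show "continuous_on {0..t} (\<lambda>t. N' t \<omega>)" for t \<omega>
      by (cases "\<omega> \<in> G") (auto simp: N'_def intro: continuous_on_subset[OF cont_N])
    show "continuous_on {0..t} (\<lambda>t. X' t \<omega>)" for t \<omega>
    proof (cases "\<omega> \<in> G \<and> 0 \<le> t")
      case True
      have "continuous_on {0..t} (\<lambda>t. X 0 \<omega> - lam * integral {0..t} (\<lambda>s. X s \<omega>) + N t \<omega>)"
        using True
        by (intro continuous_intros indefinite_integral_continuous_1 continuous_on_subset[OF cont_N] eq(1))
          auto
      then have "continuous_on {0..t} (\<lambda>t. X t \<omega>)"
        by (rule continuous_on_eq) (rule eq(2)[symmetric], use True in auto)
      then show ?thesis
        using True by (simp add: X'_def)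
    qed (auto simp: X'_def)
    show "X' t \<omega> = X' 0 \<omega> - lam * integral {0..t} (\<lambda>s. X' s \<omega>) + N' t \<omega>" if "0 \<le> t" for t \<omega>
      using eq(2)[of \<omega> t] that by (cases "\<omega> \<in> G") (simp_all add: X'_def N'_def)
    show "integrable M (\<lambda>\<omega>. (N' t \<omega>)\<^sup>2)" for t
      using N_int[of t] AE_N'[of t] by (subst integrable_cong_AE[where g = "\<lambda>\<omega>. (N t \<omega>)\<^sup>2"]) auto
    show "expectation (N' t) = 0" for t
      using mean[of t] AE_N'[of t] by (subst integral_cong_AE[where g = "N t"]) auto
    show "expectation (\<lambda>\<omega>. (N' t \<omega>)\<^sup>2) = t powr (2 * H)" if "0 \<le> t" for t
      using var[of t] AE_N'[of t] that by (subst integral_cong_AE[where g = "\<lambda>\<omega>. (N t \<omega>)\<^sup>2"]) auto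
    have distr: "distr M borel (X' t) = distr M borel (X t)" for t
      by (rule distr_cong_AE) (auto intro: AE_X')
    show "distr M borel (X' t) = distr M borel (X' 0)" for t
      unfolding distr by (rule stationary_process_distr1[OF X])
    have cov: "expectation (\<lambda>\<omega>. X' t \<omega> * X' s \<omega>) = expectation (\<lambda>\<omega>. X t \<omega> * X s \<omega>)" for s t
    proof (rule integral_cong_AE)
      show "AE \<omega> in M. X' t \<omega> * X' s \<omega> = X t \<omega> * X s \<omega>"
        using AE_X'[of s] AE_X'[of t] by eventually_elim simp
    qed auto
    show "expectation (\<lambda>\<omega>. X' t \<omega> * X' s \<omega>) = expectation (\<lambda>\<omega>. X' (t - s) \<omega> * X' 0 \<omega>)" for s t
      unfolding cov using stationary_process_expectation_mult[OF X, of "t - s" s 0 0 0] by simp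
  qed (use lam in auto)
  then show thesis
    using AE_X' by (rule that)
qed

theorem corollary2p6:
  fixes M :: "'a measure" and N X :: "real \<Rightarrow> 'a \<Rightarrow> real" and H lam :: real
  assumes "0 < H" and "H < 1" and "0 < lam"
    and "fractional_Brownian_motion M H N"
    and "QOU_process M lam N X"
  shows "(H \<noteq> 1 / 2 \<longrightarrow>
            autocov M X \<sim>[at_top] (\<lambda>t. H * (2 * H - 1) / lam\<^sup>2 * t powr (2 * H - 2))) \<and>
         autocov_compl M X \<sim>[at 0] (\<lambda>t. 1 / 2 * \<bar>t\<bar> powr (2 * H))"
proof -
  obtain N' X' where "langevin M N' X' H lam" and AE_X': "\<And>t. AE \<omega> in M. X' t \<omega> = X t \<omega>"
    using QOU_continuous_modification[OF assms(4,5)] by blast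
  then interpret L: langevin M N' X' H lam
    by blast
  have X: "stationary_process M X"
    using assms(5) by (simp add: QOU_process_def)
  have [measurable]: "X t \<in> borel_measurable M" for t
    using X by (simp add: stationary_process_def real_process_def)
  have mean: "integral\<^sup>L M (X t) = integral\<^sup>L M (X' t)" for t
    by (rule integral_cong_AE) (use AE_X'[of t] in auto)
  \<comment> \<open>The covariance involves only two fixed times, so almost-everywhere equality at
    each time suffices.\<close>
  have autocov: "autocov M X t = L.R t" if "0 \<le> t" for t
  proof -
    have "autocov M X t = covariance M (X' t) (X' 0)"
      unfolding autocov_def covariance_def mean
    proof (rule integral_cong_AE)
      show "AE \<omega> in M. (X t \<omega> - integral\<^sup>L M (X' t)) * (X 0 \<omega> - integral\<^sup>L M (X' 0)) =
          (X' t \<omega> - integral\<^sup>L M (X' t)) * (X' 0 \<omega> - integral\<^sup>L M (X' 0))"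
        using AE_X'[of t] AE_X'[of 0] by eventually_elim simp
    qed auto
    then show ?thesis
      using L.covariance_eq_R[OF that] by simp
  qed
  have "autocov M X \<sim>[at_top] (\<lambda>t. H * (2 * H - 1) / lam\<^sup>2 * t powr (2 * H - 2))" if "H \<noteq> 1 / 2"
  proof (rule asymp_equiv_transfer[OF L.asymp_at_top[OF that]])
    show "eventually (\<lambda>t. L.R t = autocov M X t) at_top"
      using eventually_ge_at_top[of 0] by eventually_elim (simp add: autocov)
  qed simp
  moreover have "autocov_compl M X \<sim>[at 0] (\<lambda>t. 1 / 2 * \<bar>t\<bar> powr (2 * H))"
  proof (rule asymp_equivI')
    let ?q = "\<lambda>t. autocov_compl M X t / (1 / 2 * \<bar>t\<bar> powr (2 * H))"
    have "eventually (\<lambda>t. (L.R 0 - L.R t) / (1 / 2 * \<bar>t\<bar> powr (2 * H)) = ?q t) (at_right 0)"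
      using eventually_at_right_less[of 0]
      by eventually_elim (simp add: autocov_compl_def autocov)
    then have "(?q \<longlongrightarrow> 1) (at_right 0)"
      by (rule Lim_transform_eventually[OF L.asymp_at_0])
    \<comment> \<open>The autocovariance is even, so the limit from the right also gives the limit
      from the left.\<close>
    moreover have "?q (- t) = ?q t" for t
      by (simp add: autocov_compl_def autocov_minus[OF X])
    then have "(?q \<longlongrightarrow> 1) (at_left 0) \<longleftrightarrow> (?q \<longlongrightarrow> 1) (at_right 0)"
      by (simp only: filterlim_at_left_to_right minus_zero)
    ultimately show "(?q \<longlongrightarrow> 1) (at 0)"
      by (simp only: filterlim_at_split)
  qed
  ultimately show ?thesis
    by blast
qed

end
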